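(* Let $d \ge 1$, let $U$ be a unitary operator on $\mathbb{C}^d$, and let $z \in \mathbb{C}^d$ satisfy $\|z\| = 1$. Put $\Theta := \operatorname{span}\{z\}^\perp$, $P := \mathbb{I} - |z\rangle\langle z|$, and $W := \bigoplus_{\lambda \in \sigma(U)} (\Theta \cap V_\lambda)$, where $V_\lambda := \operatorname{Ker}(U - \lambda \mathbb{I})$. Let $r$ be a real number with $\rho(PU|_{W^\perp \cap \Theta}) < r < 1$. Then for all sufficiently large $n \in \mathbb{N}$ we have $$\|(PU)^n z\| < r^n.$$
   Context: $\mathbb{C}^d$ carries the standard Hermitian inner product and Euclidean norm $\|\cdot\|$. $|z\rangle\langle z|$ is the orthogonal projection onto $\operatorname{span}\{z\}$, so $P$ is the orthogonal projection onto $\Theta$. $\sigma(U)$ denotes the set of eigenvalues of $U$. The subspace $W$ is the maximal subspace of $\Theta$ that is invariant under $U$. The operator $PU$ maps $W^\perp \cap \Theta$ into itself, and $PU|_{W^\perp \cap \Theta}$ denotes the resulting endomorphism. $\rho$ denotes the spectral radius, i.e., the largest absolute value of the eigenvalues of an operator; the spectral radius of the operator on the zero space is taken to be $0$. It is known that $\rho(PU|_{W^\perp \cap \Theta}) < 1$, so such $r$ exist. *)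

theory Defs
  imports "HOL-Analysis.Analysis"
begin

text \<open>
  \<open>\<complex>\<^sup>d\<close> is rendered as \<^typ>\<open>complex ^ 'n\<close> with \<open>d = CARD('n) \<ge> 1\<close>. Complex-linear notions use the
  complex scaling \<open>*s\<close>, hence \<open>vec.span\<close>; the unqualified \<open>span\<close>, \<open>linear\<close>, and
  \<open>\<bullet>\<close> of the library refer to the underlying real space.
\<close>

definition herm :: "complex ^ 'n \<Rightarrow> complex ^ 'n \<Rightarrow> complex" where
  "herm x y = (\<Sum>i\<in>UNIV. cnj (x $ i) * y $ i)"

lemma norm_eq_sqrt_herm: "norm x = sqrt (Re (herm x x))"
proof -
  have "Re (cnj w * w) = (cmod w)\<^sup>2" for w
    by (simp only: cmod_power2) (simp add: power2_eq_square)
  then show ?thesis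
    by (simp add: herm_def norm_vec_def L2_set_def)
qed

definition unitary_op :: "(complex ^ 'n \<Rightarrow> complex ^ 'n) \<Rightarrow> bool" where
  "unitary_op U \<longleftrightarrow>
     Vector_Spaces.linear (*s) (*s) U \<and> surj U \<and> (\<forall>x y. herm (U x) (U y) = herm x y)"

definition orth_compl :: "(complex ^ 'n) set \<Rightarrow> (complex ^ 'n) set" where
  "orth_compl S = {x. \<forall>s\<in>S. herm s x = 0}"

text \<open>The eigenvalues of the restriction of \<open>T\<close> to a \<open>T\<close>-invariant subspace \<open>S\<close>.\<close>

definition eigvals_on :: "(complex ^ 'n) set \<Rightarrow> (complex ^ 'n \<Rightarrow> complex ^ 'n) \<Rightarrow> complex set" where
  "eigvals_on S T = {l. \<exists>x\<in>S. x \<noteq> 0 \<and> T x = l *s x}"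

definition spec_radius_on :: "(complex ^ 'n) set \<Rightarrow> (complex ^ 'n \<Rightarrow> complex ^ 'n) \<Rightarrow> real" where
  "spec_radius_on S T = (if S = {0} then 0 else Max (cmod ` eigvals_on S T))"

definition eigspace :: "(complex ^ 'n \<Rightarrow> complex ^ 'n) \<Rightarrow> complex \<Rightarrow> (complex ^ 'n) set" where
  "eigspace U l = {x. U x - l *s x = 0}"

definition Theta :: "complex ^ 'n \<Rightarrow> (complex ^ 'n) set" where
  "Theta z = orth_compl (vec.span {z})"

text \<open>\<open>I - |z\<rangle>\<langle>z|\<close>; the orthogonal projection onto \<^term>\<open>Theta z\<close> when \<^term>\<open>norm z = 1\<close>.\<close>

definition P_op :: "complex ^ 'n \<Rightarrow> complex ^ 'n \<Rightarrow> complex ^ 'n" where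
  "P_op z x = x - herm z x *s z"

text \<open>
  The internal sum of a family of subspaces is the span of their union; it is direct here
  because eigenspaces for distinct eigenvalues are linearly independent.
\<close>

definition W_space :: "(complex ^ 'n \<Rightarrow> complex ^ 'n) \<Rightarrow> complex ^ 'n \<Rightarrow> (complex ^ 'n) set" where
  "W_space U z = vec.span (\<Union>l\<in>eigvals_on UNIV U. Theta z \<inter> eigspace U l)"

end

theory Submission
  imports Defs "HOL-Computational_Algebra.Fundamental_Theorem_Algebra"
begin

text \<open>
  Put \<open>T = PU\<close> and \<open>M = W\<^sup>\<bottom> \<inter> \<Theta>\<close>. Since \<open>W\<close> is spanned by eigenvectors of the unitary \<open>U\<close> that are
  orthogonal to \<open>z\<close>, \<open>T\<close> maps \<open>W\<^sup>\<bottom>\<close> into \<open>M\<close>; in particular \<open>T z \<in> M\<close>. It remains to bound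
  \<open>T\<^sup>n x\<close> for \<open>x \<in> M\<close> by a multiple of \<open>s\<^sup>n\<close>, where \<open>\<rho>(T|\<^sub>M) < s < r\<close>. By the fundamental theorem of
  algebra some product of factors \<open>T - a\<close> kills \<open>x\<close>. Induct on the number of factors: \<open>T - a\<close> is
  injective on \<open>M\<close> and can be dropped unless \<open>a\<close> is an eigenvalue of \<open>T|\<^sub>M\<close>, and then \<open>|a| < s\<close>, so that
  the bound for \<open>y = T x - a x\<close> passes to \<open>x\<close> through \<open>T\<^sup>n\<^sup>+\<^sup>1 x = a T\<^sup>n x + T\<^sup>n y\<close>.
\<close>

section \<open>Products of factors \<open>T - a\<close> and polynomials in an operator\<close>

lemma norm_vector_smult: "norm (c *s x) = cmod c * norm (x :: complex ^ 'n)"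
  by (simp add: norm_vec_def norm_mult L2_set_right_distrib)

lemma vec_linearI:
  assumes "\<And>x y. f (x + y) = f x + f y" "\<And>c x. f (c *s x) = c *s f x"
  shows "Vector_Spaces.linear (*s) (*s) (f :: 'a :: field ^ 'n \<Rightarrow> 'a ^ 'm)"
  using assms by (simp add: Vector_Spaces.linear_iff vec.vector_space_axioms)

text \<open>A polynomial in \<open>T\<close> kept as the list of its roots with multiplicity, so
  that inductions can remove one factor at a time. The head of the list is the factor applied
  last.\<close>

primrec shift_prod :: "(complex ^ 'n \<Rightarrow> complex ^ 'n) \<Rightarrow> complex list \<Rightarrow> complex ^ 'n \<Rightarrow> complex ^ 'n"
  where
    "shift_prod T [] x = x"
  | "shift_prod T (a # as) x = T (shift_prod T as x) - a *s shift_prod T as x"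

lemma shift_prod_append: "shift_prod T (as @ bs) x = shift_prod T as (shift_prod T bs x)"
  by (induction as) auto

definition poly_act :: "(complex ^ 'n \<Rightarrow> complex ^ 'n) \<Rightarrow> complex poly \<Rightarrow> complex ^ 'n \<Rightarrow> complex ^ 'n"
  where "poly_act T p x = (\<Sum>i\<le>degree p. coeff p i *s (T ^^ i) x)"

text \<open>Padding with zero coefficients lets polynomials of different degrees be compared over
  one index range.\<close>

lemma poly_act_eq_sum:
  assumes "degree p \<le> N"
  shows "poly_act T p x = (\<Sum>i\<le>N. coeff p i *s (T ^^ i) x)"
  unfolding poly_act_def
  by (rule sum.mono_neutral_left) (use assms in \<open>auto simp: coeff_eq_0\<close>)

lemma poly_act_add: "poly_act T (p + q) x = poly_act T p x + poly_act T q x"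
proof -
  let ?N = "max (degree p) (degree q)"
  have "degree (p + q) \<le> ?N" by (rule degree_add_le_max)
  then show ?thesis
    by (simp add: poly_act_eq_sum[of _ ?N] vector_sadd_rdistrib sum.distrib)
qed

lemma poly_act_smult: "poly_act T (smult c p) x = c *s poly_act T p x"
  by (simp add: poly_act_eq_sum[of _ "degree p"] degree_smult_le vec.scale_sum_right)

lemma poly_act_pCons: "poly_act T (pCons c p) x = c *s x + poly_act T p (T x)"
proof -
  have "poly_act T (pCons c p) x = (\<Sum>i\<le>Suc (degree p). coeff (pCons c p) i *s (T ^^ i) x)"
    by (rule poly_act_eq_sum) (simp add: degree_pCons_le)
  also have "\<dots> = c *s x + (\<Sum>i\<le>degree p. coeff p i *s (T ^^ i) (T x))"
    by (subst sum.atMost_Suc_shift) (simp add: funpow_swap1)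
  finally show ?thesis by (simp add: poly_act_def)
qed

context
  fixes T :: "complex ^ 'n \<Rightarrow> complex ^ 'n"
  assumes lin: "Vector_Spaces.linear (*s) (*s) T"
begin

lemma T_add: "T (x + y) = T x + T y"
  and T_diff: "T (x - y) = T x - T y"
  and T_smult: "T (c *s x) = c *s T x"
  using vec.linear_add[OF lin] vec.linear_diff[OF lin] vec.linear_scale[OF lin]
  by auto

lemma linear_funpow: "Vector_Spaces.linear (*s) (*s) (T ^^ n)"
proof (induction n)
  case 0
  show ?case using vec.linear_id by (simp add: id_def)
next
  case (Suc n)
  show ?case using Vector_Spaces.linear_compose[OF Suc lin] by (simp add: comp_def)
qed

lemma linear_shift_prod: "Vector_Spaces.linear (*s) (*s) (shift_prod T as)"
proof (rule vec_linearI)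
  show "shift_prod T as (x + y) = shift_prod T as x + shift_prod T as y" for x y
    by (induction as) (auto simp: T_add vec.scale_right_distrib algebra_simps)
  show "shift_prod T as (c *s x) = c *s shift_prod T as x" for c x
    by (induction as) (auto simp: T_smult vec.scale_right_diff_distrib mult.commute)
qed

lemma shift_prod_zero: "shift_prod T as 0 = 0"
  using vec.linear_0[OF linear_shift_prod] .

text \<open>All factors are polynomials in \<open>T\<close> and hence commute. This turns the
  outermost factor of a product into the innermost one.\<close>

lemma shift_prod_commute:
  "shift_prod T as (T x - a *s x) = T (shift_prod T as x) - a *s shift_prod T as x"
proof (induction as)
  case (Cons b as)
  then show ?case
    by (simp add: T_diff T_smult vec.scale_right_diff_distrib mult.commute)
qed simp

lemma shift_prod_in_subspace:
  assumes "vec.subspace M" "T ` M \<subseteq> M" "x \<in> M"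
  shows "shift_prod T as x \<in> M"
  using assms by (induction as) (auto intro!: vec.subspace_diff vec.subspace_scale)

lemma shift_prod_eigenvector:
  assumes "T x = l *s x"
  shows "shift_prod T as x = (\<Prod>a\<leftarrow>as. l - a) *s x"
proof (induction as)
  case (Cons a as)
  then show ?case
    by (simp add: T_smult assms vec.scale_left_diff_distrib left_diff_distrib mult.commute)
qed simp

lemma poly_act_linear_factor:
  "poly_act T ([:- a, 1:] * q) x = poly_act T q (T x - a *s x)"
proof -
  have "[:- a, 1:] * q = pCons 0 q + smult (- a) q"
    by simp
  then have "poly_act T ([:- a, 1:] * q) x = poly_act T q (T x) - a *s poly_act T q x"
    by (simp only: poly_act_add poly_act_smult poly_act_pCons) simp
  also have "\<dots> = poly_act T q (T x - a *s x)"
    unfolding poly_act_def vec.scale_sum_right sum_subtractf[symmetric]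
    by (rule sum.cong)
      (simp_all add: vec.linear_diff[OF linear_funpow] vec.linear_scale[OF linear_funpow]
        vec.scale_right_diff_distrib mult.commute)
  finally show ?thesis .
qed

text \<open>Each root \<open>a\<close> of \<open>p\<close> splits off a linear factor. That factor
  acts first, so the induction on the degree continues with the vector \<open>T x - a *s x\<close>
  in place of \<open>x\<close>.\<close>

lemma poly_act_eq_0_imp_shift_prod_eq_0:
  assumes "p \<noteq> 0" "poly_act T p x = 0"
  shows "\<exists>as. shift_prod T as x = 0"
  using assms
proof (induction "degree p" arbitrary: p x)
  case 0
  then obtain c where c: "p = [:c:]"
    by (metis degree_eq_zeroE)
  with 0 have "x = 0"
    by (simp add: poly_act_def)
  then show ?case
    by (intro exI[of _ "[]"]) simp
next
  case (Suc d)
  have "\<not> constant (poly p)"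
    using Suc.hyps(2) by (simp add: constant_degree)
  then obtain a where "poly p a = 0"
    using fundamental_theorem_of_algebra by blast
  then obtain q where q: "p = [:- a, 1:] * q"
    by (auto simp: poly_eq_0_iff_dvd elim: dvdE)
  with Suc.prems have "q \<noteq> 0" by auto
  then have "degree p = Suc (degree q)"
    unfolding q by (subst degree_mult_eq) auto
  with Suc.hyps(2) have "d = degree q" by simp
  moreover have "poly_act T q (T x - a *s x) = 0"
    using Suc.prems(2) by (simp only: q poly_act_linear_factor)
  ultimately obtain as where "shift_prod T as (T x - a *s x) = 0"
    using Suc.hyps(1) \<open>q \<noteq> 0\<close> by blast
  then have "shift_prod T (as @ [a]) x = 0"
    by (simp add: shift_prod_append)
  then show ?case by blast
qed

section \<open>Annihilating products\<close>

text \<open>The \<open>N + 1\<close> vectors \<open>x\<close>, \<open>T x\<close>, ...,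
  \<open>(T ^^ N) x\<close> in a space of dimension \<open>N\<close> satisfy a nontrivial linear
  relation, whose coefficients are those of \<open>p\<close>.\<close>

lemma ex_annihilating_poly: "\<exists>p. p \<noteq> 0 \<and> poly_act T p x = 0"
proof -
  define N where "N = vec.dim (UNIV :: (complex ^ 'n) set)"
  define f where "f i = (T ^^ i) x" for i
  have "\<exists>c. (\<exists>i\<le>N. c i \<noteq> 0) \<and> (\<Sum>i\<le>N. c i *s f i) = 0"
  proof (cases "inj_on f {..N}")
    \<comment> \<open>Dependence is a property of sets, which do not see repetitions. A coincidence
      \<open>f i = f j\<close> gives the relation with coefficients 1 and -1 directly.\<close>
    case False
    then obtain i j where ij: "i \<le> N" "j \<le> N" "i \<noteq> j" "f i = f j"
      by (auto simp: inj_on_def)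
    have "(\<Sum>k\<le>N. ((if k = i then 1 else 0) - (if k = j then 1 else 0)) *s f k) = f i - f j"
      using ij by (simp add: vec.scale_left_diff_distrib sum_subtractf if_distrib[of "\<lambda>c. c *s _"]
          cong: if_cong)
    with ij show ?thesis
      by (intro exI[of _ "\<lambda>k. (if k = i then 1 else 0) - (if k = j then 1 else 0)"]) auto
  next
    case True
    have "vec.dependent (f ` {..N})"
    proof (rule ccontr)
      assume "vec.independent (f ` {..N})"
      then have "card (f ` {..N}) \<le> N"
        unfolding N_def by (intro vec.independent_card_le_dim) auto
      with True show False by (simp add: card_image)
    qed
    then obtain u where u: "\<exists>v\<in>f ` {..N}. u v \<noteq> 0" "(\<Sum>v\<in>f ` {..N}. u v *s v) = 0"
      by (auto simp: vec.dependent_finite)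
    with True show ?thesis
      by (intro exI[of _ "u \<circ> f"]) (auto simp: sum.reindex)
  qed
  then obtain c i where c: "i \<le> N" "c i \<noteq> 0" "(\<Sum>i\<le>N. c i *s f i) = 0"
    by blast
  define p where "p = (\<Sum>i\<le>N. monom (c i) i)"
  have coeff: "coeff p i = (if i \<le> N then c i else 0)" for i
    by (simp add: p_def coeff_sum)
  have "degree p \<le> N"
    by (rule degree_le) (simp add: coeff)
  then have "poly_act T p x = 0"
    using c(3) by (simp add: poly_act_eq_sum[of _ N] coeff f_def)
  moreover have "p \<noteq> 0"
    using c(1,2) coeff[of i] by auto
  ultimately show ?thesis by blast
qed

lemma ex_shift_prod_eq_0: "\<exists>as. shift_prod T as x = 0"
  using ex_annihilating_poly poly_act_eq_0_imp_shift_prod_eq_0 by blast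

lemma ex_shift_prod_eq_0_on_finite:
  assumes "finite B"
  shows "\<exists>as. \<forall>x\<in>B. shift_prod T as x = 0"
  using assms
proof (induction B rule: finite_induct)
  case (insert b B)
  then obtain as where as: "\<forall>x\<in>B. shift_prod T as x = 0" by blast
  \<comment> \<open>The new factors are chosen for the vector that \<open>as\<close> has already
    acted on; they send the zeros obtained so far to zero.\<close>
  obtain bs where bs: "shift_prod T bs (shift_prod T as b) = 0"
    using ex_shift_prod_eq_0 by blast
  have "\<forall>x\<in>insert b B. shift_prod T (bs @ as) x = 0"
    using as bs by (auto simp: shift_prod_append shift_prod_zero)
  then show ?case by blast
qed simp

section \<open>Eigenvalues and spectral radius on an invariant subspace\<close>

text \<open>A product that kills a basis kills every eigenvector, so each eigenvalue is one of its
  roots. Finiteness is what gives \<open>Max\<close> in the spectral radius its meaning.\<close>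

lemma finite_eigvals_on: "finite (eigvals_on M T)"
proof -
  obtain B :: "(complex ^ 'n) set" where B: "finite B" "vec.span B = UNIV"
    using vec.finite_Basis vec.span_Basis by blast
  from ex_shift_prod_eq_0_on_finite[OF B(1)]
  obtain as where as: "\<And>x. x \<in> B \<Longrightarrow> shift_prod T as x = 0" by blast
  have kill: "shift_prod T as x = 0" for x
    using vec.linear_eq_0_on_span[OF linear_shift_prod as] B(2) by blast
  have "eigvals_on M T \<subseteq> set as"
  proof
    fix l assume "l \<in> eigvals_on M T"
    then obtain x where "x \<noteq> 0" "T x = l *s x"
      by (auto simp: eigvals_on_def)
    then have "(\<Prod>a\<leftarrow>as. l - a) = 0"
      using kill[of x] by (simp add: shift_prod_eigenvector)
    then show "l \<in> set as"
      by (auto simp: prod_list_zero_iff)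
  qed
  then show ?thesis
    by (rule finite_subset) simp
qed

text \<open>When a product kills a nonzero \<open>x\<close> in \<open>M\<close>, some factor
  \<open>T - a\<close> is the first to send a nonzero vector to 0. That vector lies in
  \<open>M\<close> and is an eigenvector.\<close>

lemma eigvals_on_nonempty:
  assumes M: "vec.subspace M" "T ` M \<subseteq> M" and "M \<noteq> {0}"
  shows "eigvals_on M T \<noteq> {}"
proof -
  obtain x where x: "x \<in> M" "x \<noteq> 0"
    using assms vec.subspace_0 by blast
  have "shift_prod T as x = 0 \<Longrightarrow> eigvals_on M T \<noteq> {}" for as
  proof (induction as)
    case (Cons a as)
    have "shift_prod T as x \<in> M"
      by (rule shift_prod_in_subspace[OF M x(1)])
    then show ?case
      using Cons by (cases "shift_prod T as x = 0") (auto simp: eigvals_on_def)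
  qed (use x in simp)
  then show ?thesis
    using ex_shift_prod_eq_0 by blast
qed

lemma spec_radius_on_nonneg:
  assumes "vec.subspace M" "T ` M \<subseteq> M"
  shows "0 \<le> spec_radius_on M T"
proof (cases "M = {0}")
  case False
  then obtain l where "l \<in> eigvals_on M T"
    using eigvals_on_nonempty[OF assms] by blast
  then have "cmod l \<le> spec_radius_on M T"
    using False by (simp add: spec_radius_on_def finite_eigvals_on)
  then show ?thesis
    using norm_ge_zero order_trans by blast
qed (simp add: spec_radius_on_def)

text \<open>The default value on \<open>{0}\<close> does no harm: there are no eigenvalues
  there.\<close>

lemma cmod_le_spec_radius_on:
  assumes "l \<in> eigvals_on M T"
  shows "cmod l \<le> spec_radius_on M T"
  using assms by (auto simp: spec_radius_on_def finite_eigvals_on eigvals_on_def[of "{0}"])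

section \<open>Geometric decay of the powers\<close>

lemma norm_funpow_le_if_shift_prod_eq_0:
  assumes M: "vec.subspace M" "T ` M \<subseteq> M" and "x \<in> M"
    and eig: "\<And>l. l \<in> eigvals_on M T \<Longrightarrow> cmod l < s"
    and "shift_prod T as x = 0" and "0 < s"
  shows "\<exists>C. \<forall>n. norm ((T ^^ n) x) \<le> C * s ^ n"
  using assms(3,5)
proof (induction as arbitrary: x)
  case Nil
  then have "(T ^^ n) x = 0" for n
    using vec.linear_0[OF linear_funpow] by simp
  then show ?case
    by (intro exI[of _ 0]) simp
next
  case (Cons a as)
  show ?case
  proof (cases "a \<in> eigvals_on M T")
    case False
    have "shift_prod T as x \<in> M"
      by (rule shift_prod_in_subspace[OF M Cons.prems(1)])
    with False Cons.prems(2) have "shift_prod T as x = 0"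
      by (auto simp: eigvals_on_def)
    with Cons show ?thesis by blast
  next
    case True
    define y where "y = T x - a *s x"
    have "y \<in> M"
      using M Cons.prems(1) unfolding y_def
      by (auto intro!: vec.subspace_diff vec.subspace_scale)
    moreover have "shift_prod T as y = 0"
      using Cons.prems(2) by (simp add: y_def shift_prod_commute)
    ultimately obtain D where D: "\<And>n. norm ((T ^^ n) y) \<le> D * s ^ n"
      using Cons.IH by blast
    have as: "cmod a < s" by (rule eig[OF True])
    \<comment> \<open>The first entry covers \<open>n = 0\<close>; the second gives
      \<open>cmod a * C + D \<le> C * s\<close>, which carries the bound from \<open>n\<close> to
      \<open>n + 1\<close>.\<close>
    define C where "C = max (norm x) (D / (s - cmod a))"
    have "D / (s - cmod a) \<le> C"
      by (simp add: C_def)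
    then have "D \<le> C * (s - cmod a)"
      using as by (simp add: pos_divide_le_eq)
    then have DC: "cmod a * C + D \<le> C * s" by (simp add: algebra_simps)
    have "norm ((T ^^ n) x) \<le> C * s ^ n" for n
    proof (induction n)
      case 0
      show ?case by (simp add: C_def)
    next
      case (Suc n)
      have "(T ^^ Suc n) x = (T ^^ n) (a *s x + y)"
        by (simp add: y_def funpow_swap1)
      also have "\<dots> = a *s (T ^^ n) x + (T ^^ n) y"
        by (simp add: vec.linear_add[OF linear_funpow] vec.linear_scale[OF linear_funpow])
      finally have "norm ((T ^^ Suc n) x) \<le> cmod a * norm ((T ^^ n) x) + norm ((T ^^ n) y)"
        by (metis norm_triangle_ineq norm_vector_smult)
      also have "\<dots> \<le> cmod a * (C * s ^ n) + D * s ^ n"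
        by (intro add_mono mult_left_mono Suc D) simp
      also have "\<dots> = (cmod a * C + D) * s ^ n" by (simp add: algebra_simps)
      also have "\<dots> \<le> C * s * s ^ n"
        using DC \<open>0 < s\<close> by (intro mult_right_mono) auto
      finally show ?case by (simp add: algebra_simps)
    qed
    then show ?thesis by blast
  qed
qed

lemma eventually_norm_funpow_less:
  assumes M: "vec.subspace M" "T ` M \<subseteq> M" and "x \<in> M"
    and "spec_radius_on M T < r" and "0 < c"
  shows "\<forall>\<^sub>F n in sequentially. norm ((T ^^ n) x) < c * r ^ n"
proof -
  obtain s where s: "spec_radius_on M T < s" "s < r"
    using assms(4) dense by blast
  have "0 < s" using spec_radius_on_nonneg[OF M] s(1) by linarith
  obtain as where "shift_prod T as x = 0" using ex_shift_prod_eq_0 by blast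
  moreover have "cmod l < s" if "l \<in> eigvals_on M T" for l
    using cmod_le_spec_radius_on[OF that] s(1) by linarith
  ultimately obtain C where C: "\<And>n. norm ((T ^^ n) x) \<le> C * s ^ n"
    using norm_funpow_le_if_shift_prod_eq_0[OF M \<open>x \<in> M\<close>] \<open>0 < s\<close> by blast
  \<comment> \<open>The gap between \<open>s\<close> and \<open>r\<close> absorbs the constant
    \<open>C\<close>.\<close>
  have "(\<lambda>n. (s / r) ^ n) \<longlonglongrightarrow> 0"
    using \<open>0 < s\<close> s(2) by (intro LIMSEQ_power_zero) simp
  then have "(\<lambda>n. C * (s / r) ^ n) \<longlonglongrightarrow> 0"
    using tendsto_mult_right_zero by blast
  then have "\<forall>\<^sub>F n in sequentially. C * (s / r) ^ n < c"
    using \<open>0 < c\<close> by (rule order_tendstoD)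
  then show ?thesis
  proof eventually_elim
    case (elim n)
    have "C * s ^ n < c * r ^ n"
      using elim \<open>0 < s\<close> s(2) by (simp add: power_divide pos_divide_less_eq)
    with C[of n] show ?case by linarith
  qed
qed

end

section \<open>The Hermitian form, orthogonal complements and the operator \<open>PU\<close>\<close>

lemma herm_add_right: "herm x (y + z) = herm x y + herm x z"
  and herm_diff_right: "herm x (y - z) = herm x y - herm x z"
  and herm_smult_right: "herm x (c *s y) = c * herm x y"
  and herm_add_left: "herm (x + y) z = herm x z + herm y z"
  and herm_smult_left: "herm (c *s x) y = cnj c * herm x y"
  and herm_zero_left: "herm 0 x = 0"
  and herm_zero_right: "herm x 0 = 0"
  by (simp_all add: herm_def algebra_simps sum.distrib sum_subtractf sum_distrib_left)

lemma herm_eq_0_commute: "herm x y = 0 \<longleftrightarrow> herm y x = 0"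
proof -
  have "herm x y = cnj (herm y x)" by (simp add: herm_def mult.commute)
  then show ?thesis by simp
qed

lemma herm_self: "herm x x = of_real ((norm x)\<^sup>2)"
  unfolding norm_vec_def L2_set_def herm_def
  by (simp add: sum_nonneg complex_norm_square mult.commute del: of_real_power)

lemma orth_compl_span: "orth_compl (vec.span S) = orth_compl S"
proof
  show "orth_compl (vec.span S) \<subseteq> orth_compl S"
    by (auto simp: orth_compl_def vec.span_base)
  show "orth_compl S \<subseteq> orth_compl (vec.span S)"
  proof
    fix x assume x: "x \<in> orth_compl S"
    have "herm s x = 0" if "s \<in> vec.span S" for s
      using that
    proof (induction s rule: vec.span_induct_alt)
      case (step c y t)
      then show ?case using x by (auto simp: orth_compl_def herm_add_left herm_smult_left)
    qed (simp add: herm_zero_left)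
    then show "x \<in> orth_compl (vec.span S)" by (simp add: orth_compl_def)
  qed
qed

lemma subspace_orth_compl: "vec.subspace (orth_compl S)"
  by (auto simp: vec.subspace_def orth_compl_def herm_zero_right herm_add_right herm_smult_right)

lemma mem_Theta_iff: "x \<in> Theta z \<longleftrightarrow> herm z x = 0"
  by (simp add: Theta_def orth_compl_span) (simp add: orth_compl_def)

lemma P_op_in_Theta:
  assumes "norm z = 1"
  shows "P_op z x \<in> Theta z"
  using assms by (simp add: mem_Theta_iff P_op_def herm_diff_right herm_smult_right herm_self)

text \<open>Unitarity gives \<open>cnj l * herm w (U x) = herm w x\<close>, and \<open>l\<close> is
  nonzero because \<open>U\<close> preserves the norm of \<open>w\<close>. Projecting only subtracts
  a multiple of \<open>z\<close>, which is orthogonal to \<open>w\<close>.\<close>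

lemma P_op_U_orth:
  assumes U: "unitary_op U" and w: "w \<in> Theta z \<inter> eigspace U l" and x: "herm w x = 0"
  shows "herm w (P_op z (U x)) = 0"
proof (cases "w = 0")
  case False
  have Uw: "U w = l *s w" using w by (simp add: eigspace_def)
  have iso: "herm (U a) (U b) = herm a b" for a b
    using U by (simp add: unitary_op_def)
  have "l \<noteq> 0"
    using iso[of w w] False by (auto simp: Uw herm_zero_left herm_self)
  moreover have "cnj l * herm w (U x) = 0"
    using iso[of w x] x by (simp add: Uw herm_smult_left)
  ultimately have "herm w (U x) = 0" by simp
  moreover have "herm w z = 0"
    using w by (simp add: mem_Theta_iff herm_eq_0_commute[of w z])
  ultimately show ?thesis
    by (simp add: P_op_def herm_diff_right herm_smult_right)
qed (simp add: herm_zero_left)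

theorem theorem2:
  fixes U :: "complex ^ 'n \<Rightarrow> complex ^ 'n" and z :: "complex ^ 'n" and r :: real
  assumes "unitary_op U"
    and "norm z = 1"
    and "spec_radius_on (orth_compl (W_space U z) \<inter> Theta z) (P_op z \<circ> U) < r"
    and "r < 1"
  shows "\<forall>\<^sub>F n in sequentially. norm (((P_op z \<circ> U) ^^ n) z) < r ^ n"
proof -
  define T where "T = P_op z \<circ> U"
  define G where "G = (\<Union>l\<in>eigvals_on UNIV U. Theta z \<inter> eigspace U l)"
  define M where "M = orth_compl (W_space U z) \<inter> Theta z"
  \<comment> \<open>Orthogonality to \<open>W\<close> need only be tested on the eigenvectors that
    span it.\<close>
  have M_eq: "M = orth_compl G \<inter> Theta z"
    by (simp add: M_def W_space_def G_def orth_compl_span)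
  have U_lin: "Vector_Spaces.linear (*s) (*s) U"
    using assms(1) by (simp add: unitary_op_def)
  have T_lin: "Vector_Spaces.linear (*s) (*s) T"
    by (rule vec_linearI)
      (simp_all add: T_def P_op_def vec.linear_add[OF U_lin] vec.linear_scale[OF U_lin]
        herm_add_right herm_smult_right vec.scale_left_distrib vec.scale_right_diff_distrib)
  have M_sub: "vec.subspace M"
    unfolding M_def Theta_def by (intro vec.subspace_inter subspace_orth_compl)
  \<comment> \<open>Stated for all of \<open>orth_compl G\<close>, so that it covers
    \<open>z\<close>, which is not in \<open>Theta z\<close>, as well as \<open>M\<close>.\<close>
  have T_M: "T x \<in> M" if "x \<in> orth_compl G" for x
    using that P_op_in_Theta[OF assms(2)] P_op_U_orth[OF assms(1)]
    by (fastforce simp: M_eq T_def orth_compl_def G_def)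
  then have T_inv: "T ` M \<subseteq> M" by (auto simp: M_eq)
  have "z \<in> orth_compl G"
    by (auto simp: orth_compl_def G_def mem_Theta_iff herm_eq_0_commute[of _ z])
  then have Tz: "T z \<in> M" by (rule T_M)
  have rho: "spec_radius_on M T < r"
    using assms(3) by (simp add: M_def T_def)
  then have "0 < r"
    using spec_radius_on_nonneg[OF T_lin M_sub T_inv] by linarith
  \<comment> \<open>Starting from \<open>T z\<close> costs one power of \<open>T\<close>; the choice
    \<open>c = r\<close> supplies the matching power of \<open>r\<close>.\<close>
  then have "\<forall>\<^sub>F n in sequentially. norm ((T ^^ n) (T z)) < r * r ^ n"
    by (rule eventually_norm_funpow_less[OF T_lin M_sub T_inv Tz rho])
  then have "\<forall>\<^sub>F n in sequentially. norm ((T ^^ Suc n) z) < r ^ Suc n"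
    by (simp add: funpow_swap1)
  then show ?thesis
    unfolding T_def eventually_sequentially_Suc[of "\<lambda>n. norm (((P_op z \<circ> U) ^^ n) z) < r ^ n"] .
qed

end
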